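(* Let $(\Omega,\Sigma,\mu)$ be a measure space and let $Y$ be a strictly convex Banach space over $\mathbb K\in\{\mathbb R,\mathbb C\}$. Given $u\in L_1(\mu)\widehat{\otimes}_\pi Y$, the following assertions are equivalent: (i) $u\in \mathrm{NA}_\pi(L_1(\mu)\widehat{\otimes}_\pi Y)$. (ii) $u=\sum_{i=1}^\infty f_i\otimes y_i$ for some $f_i\in L_1(\mu)$, $y_i\in Y$ with $\mu(\operatorname{supp} f_i\cap\operatorname{supp} f_j)=0$ for all $i\neq j$. (iii) There is a sequence $(y_n)_{n\in\mathbb N}\subseteq S_Y$ such that $$\mu\Big\{\omega\in\Omega: u(\omega)\notin\bigcup_{n\in\mathbb N}\operatorname{span}\{y_n\}\Big\}=0.$$
   Context: $X\widehat{\otimes}_\pi Y$ denotes the projective tensor product of Banach spaces. An element $u\in X\widehat{\otimes}_\pi Y$ attains its projective norm if there are $(x_i)\subseteq X$, $(y_i)\subseteq Y$ with $u=\sum_{i=1}^\infty x_i\otimes y_i$ and $\|u\|_\pi=\sum_{i=1}^\infty\|x_i\|\|y_i\|$; $\mathrm{NA}_\pi(X\widehat{\otimes}_\pi Y)$ is the set of such elements. $L_1(\mu)\widehat{\otimes}_\pi Y$ is isometrically identified with the space $L_1(\mu,Y)$ of Bochner integrable functions via $(f\otimes y)(\omega)=f(\omega)y$. Infinite sums converge in norm. $\operatorname{supp} f=\{\omega: f(\omega)\neq0\}$ (up to a null set). $S_Y$ is the unit sphere of $Y$. $Y$ is strictly convex if $\|x+y\|<2$ for all distinct $x,y\in S_Y$.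 *)

theory Defs
  imports "HOL-Analysis.Analysis"
begin

text \<open>
  Scalars range over a type of sort \<open>{real_normed_field, banach, second_countable_topology}\<close>.
  Its norm is multiplicative, so by the Gelfand--Mazur theorem such a type is isometrically
  isomorphic to \<open>real\<close> or to \<open>complex\<close>, both of which are instances. The Banach space is a whole
  type; its scalar multiplication is a parameter, since HOL-Analysis has no class of complex normed
  spaces.
\<close>

locale banach_space_over = vector_space scl
  for scl :: "'k::{real_normed_field, banach, second_countable_topology} \<Rightarrow> 'b::banach \<Rightarrow> 'b" +
  assumes norm_scale: "norm (scl c y) = norm c * norm y"
    and scale_of_real: "scl (of_real r) y = r *\<^sub>R y"

definition strictly_convex :: "'b::real_normed_vector itself \<Rightarrow> bool" where
  "strictly_convex _ \<longleftrightarrow>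
     (\<forall>x\<in>sphere (0::'b) 1. \<forall>y\<in>sphere 0 1. x \<noteq> y \<longrightarrow> norm (x + y) < 2)"

text \<open>
  The library predicate \<open>integrable\<close> needs a second countable codomain, which would restrict us to
  separable Banach spaces, so strong measurability is spelled out. Every class in \<open>L\<^sub>1(\<mu>, Y)\<close> has
  a representative that is an everywhere limit of simple functions. The simple functions need not
  have support of finite measure: finiteness of the integral of the norm makes the support of \<open>u\<close>
  sigma-finite, so the two versions agree.
\<close>

definition bochner_L1 :: "'a measure \<Rightarrow> ('a \<Rightarrow> 'b::banach) \<Rightarrow> bool" where
  "bochner_L1 M u \<longleftrightarrow>
     (\<exists>s. (\<forall>n. simple_function M (s n)) \<and> (\<forall>\<omega>\<in>space M. (\<lambda>n. s n \<omega>) \<longlonglongrightarrow> u \<omega>)) \<and>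
     (\<integral>\<^sup>+\<omega>. ennreal (norm (u \<omega>)) \<partial>M) < \<infinity>"

definition tensor :: "('k \<Rightarrow> 'b \<Rightarrow> 'b) \<Rightarrow> ('a \<Rightarrow> 'k) \<Rightarrow> 'b \<Rightarrow> 'a \<Rightarrow> 'b" where
  "tensor scl f y = (\<lambda>\<omega>. scl (f \<omega>) y)"

text \<open>
  \<open>u = (\<Sum>i. f\<^sub>i \<otimes> y\<^sub>i)\<close> with \<open>f\<^sub>i\<close> in \<open>L\<^sub>1(\<mu>)\<close> and convergence in the norm of \<open>L\<^sub>1(\<mu>, Y)\<close>;
  in particular the equality is one of classes modulo null sets.
\<close>

definition tensor_sums ::
  "'a measure \<Rightarrow> ('k::{real_normed_field, banach, second_countable_topology} \<Rightarrow> 'b::banach \<Rightarrow> 'b)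
    \<Rightarrow> (nat \<Rightarrow> 'a \<Rightarrow> 'k) \<Rightarrow> (nat \<Rightarrow> 'b) \<Rightarrow> ('a \<Rightarrow> 'b) \<Rightarrow> bool" where
  "tensor_sums M scl f y u \<longleftrightarrow>
     (\<forall>i. integrable M (f i)) \<and>
     (\<lambda>n. \<integral>\<^sup>+\<omega>. ennreal (norm (u \<omega> - (\<Sum>i<n. tensor scl (f i) (y i) \<omega>))) \<partial>M) \<longlonglongrightarrow> 0"

definition L1_norm :: "'a measure \<Rightarrow> ('a \<Rightarrow> 'k::real_normed_vector) \<Rightarrow> real" where
  "L1_norm M f = (\<integral>\<omega>. norm (f \<omega>) \<partial>M)"

text \<open>
  The projective norm on the completed tensor product, which is realised as \<open>L\<^sub>1(\<mu>, Y)\<close>: the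
  infimum of \<open>\<Sum>i. \<parallel>f\<^sub>i\<parallel> \<parallel>y\<^sub>i\<parallel>\<close> over all representations for which this series converges.
\<close>

definition projective_norm ::
  "'a measure \<Rightarrow> ('k::{real_normed_field, banach, second_countable_topology} \<Rightarrow> 'b::banach \<Rightarrow> 'b)
    \<Rightarrow> ('a \<Rightarrow> 'b) \<Rightarrow> real" where
  "projective_norm M scl u =
     Inf {(\<Sum>i. L1_norm M (f i) * norm (y i)) | f y.
            tensor_sums M scl f y u \<and> summable (\<lambda>i. L1_norm M (f i) * norm (y i))}"

definition NA_proj ::
  "'a measure \<Rightarrow> ('k::{real_normed_field, banach, second_countable_topology} \<Rightarrow> 'b::banach \<Rightarrow> 'b)
    \<Rightarrow> ('a \<Rightarrow> 'b) set" where
  "NA_proj M scl =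
     {u. bochner_L1 M u \<and>
         (\<exists>f y. tensor_sums M scl f y u \<and>
            (\<lambda>i. L1_norm M (f i) * norm (y i)) sums projective_norm M scl u)}"

end

theory Submission
  imports Defs
begin

text \<open>
  The projective norm of \<open>u\<close> is \<open>\<integral>\<parallel>u\<parallel>\<close>. If \<open>u = (\<Sum>i. f\<^sub>i \<otimes> y\<^sub>i)\<close> attains it, then
  \<open>\<parallel>u(\<omega>)\<parallel> = (\<Sum>i. \<parallel>f\<^sub>i(\<omega>) y\<^sub>i\<parallel>)\<close> for almost every \<open>\<omega>\<close>, and strict convexity puts \<open>u(\<omega>)\<close> on the line
  through each nonzero summand. Conversely, if the values of \<open>u\<close> lie on countably many lines, cut the
  space according to the first line that contains \<open>u(\<omega>)\<close>: the resulting terms have disjoint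
  supports, and for such terms the norms add up to \<open>\<integral>\<parallel>u\<parallel>\<close>.

  Representations with sum of norms close to \<open>\<integral>\<parallel>u\<parallel>\<close> come from a pointwise greedy expansion: run
  through a sequence \<open>d\<close> that lists a countable group of approximate values infinitely often, and
  subtract \<open>d\<^sub>m\<close> at \<open>\<omega>\<close> whenever this lowers the norm of the remainder by at least \<open>q \<parallel>d\<^sub>m\<parallel>\<close>, where
  \<open>q < 1\<close>. The total cost is then at most \<open>\<parallel>u(\<omega>)\<parallel> / q\<close> by telescoping.
\<close>

section \<open>Norm-additive sums in strictly convex spaces\<close>

text \<open>Suppose \<open>norm x \<le> norm y\<close> and the two unit vectors differ. Their sum is
  \<open>(x + y) /\<^sub>R norm x\<close> minus a nonnegative multiple \<open>c\<close> of
  \<open>y\<close>, where \<open>c\<close> is the difference of the reciprocal norms. Additivity of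
  the norm then bounds its norm below by \<open>(norm x + norm y) / norm x - c * norm y = 2\<close>,
  against strict convexity.\<close>

lemma strictly_convex_norm_add_eq:
  fixes x y :: "'b::real_normed_vector"
  assumes sc: "strictly_convex TYPE('b)"
    and eq: "norm (x + y) = norm x + norm y" and "x \<noteq> 0" "y \<noteq> 0"
  shows "x /\<^sub>R norm x = y /\<^sub>R norm y"
proof -
  have *: "x /\<^sub>R norm x = y /\<^sub>R norm y"
    if eq: "norm (x + y) = norm x + norm y" and nz: "x \<noteq> 0" "y \<noteq> 0" and le: "norm x \<le> norm y"
    for x y :: 'b
  proof (rule ccontr)
    assume ne: "x /\<^sub>R norm x \<noteq> y /\<^sub>R norm y"
    define c where "c = inverse (norm x) - inverse (norm y)"
    have c: "c \<ge> 0"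
      unfolding c_def using le nz by (simp add: le_imp_inverse_le)
    have "x /\<^sub>R norm x + y /\<^sub>R norm y = (x + y) /\<^sub>R norm x - c *\<^sub>R y"
      unfolding c_def by (simp add: algebra_simps)
    then have "norm (x /\<^sub>R norm x + y /\<^sub>R norm y) \<ge> norm ((x + y) /\<^sub>R norm x) - norm (c *\<^sub>R y)"
      by (metis norm_triangle_ineq2)
    also have "norm ((x + y) /\<^sub>R norm x) - norm (c *\<^sub>R y)
        = (norm x + norm y) / norm x - c * norm y"
      using c by (simp add: eq divide_inverse_commute)
    also have "\<dots> = 2"
      unfolding c_def using nz by (simp add: field_simps)
    finally have "2 \<le> norm (x /\<^sub>R norm x + y /\<^sub>R norm y)" .
    moreover have "norm (x /\<^sub>R norm x + y /\<^sub>R norm y) < 2"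
      using sc ne nz unfolding strictly_convex_def by auto
    ultimately show False by simp
  qed
  show ?thesis
  proof (cases "norm x \<le> norm y")
    case True
    then show ?thesis using *[of x y] assms by simp
  next
    case False
    then show ?thesis using *[of y x] assms by (simp add: add.commute)
  qed
qed

text \<open>With \<open>z j\<close> split off, equality for the whole series forces equality in the
  triangle inequality between \<open>z j\<close> and the sum of the other terms. If that sum is
  nonzero, the two-vector case gives it the direction of \<open>z j\<close>.\<close>

lemma strictly_convex_suminf_eq:
  fixes z :: "nat \<Rightarrow> 'b::banach"
  assumes sc: "strictly_convex TYPE('b)"
    and sm: "summable (\<lambda>i. norm (z i))"
    and eq: "norm (\<Sum>i. z i) = (\<Sum>i. norm (z i))"
    and nz: "z j \<noteq> 0"
  shows "\<exists>r. (\<Sum>i. z i) = r *\<^sub>R z j"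
proof -
  define w where "w i = (if i = j then 0 else z i)" for i
  define v where "v i = (if i = j then z j else 0)" for i
  have zvw: "z i = v i + w i" "norm (z i) = norm (v i) + norm (w i)" for i
    by (auto simp: v_def w_def)
  have v: "v sums z j" "(\<lambda>i. norm (v i)) sums norm (z j)"
    using sums_single[of j "\<lambda>_. z j"] sums_single[of j "\<lambda>_. norm (z j)"]
    by (simp_all add: v_def[abs_def] if_distrib[of norm] cong: if_cong)
  have sw: "summable (\<lambda>i. norm (w i))"
    by (rule summable_comparison_test'[OF sm, of 0]) (auto simp: w_def)
  have "(\<lambda>i. v i + w i) sums (z j + (\<Sum>i. w i))"
    using v(1) summable_sums[OF summable_norm_cancel[OF sw]] by (rule sums_add)
  then have s1: "(\<Sum>i. z i) = z j + (\<Sum>i. w i)"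
    by (simp add: zvw(1)[symmetric] sums_iff)
  have "(\<lambda>i. norm (v i) + norm (w i)) sums (norm (z j) + (\<Sum>i. norm (w i)))"
    using v(2) summable_sums[OF sw] by (rule sums_add)
  then have s2: "(\<Sum>i. norm (z i)) = norm (z j) + (\<Sum>i. norm (w i))"
    by (simp add: zvw(2)[symmetric] sums_iff)
  have "norm (\<Sum>i. w i) \<le> (\<Sum>i. norm (w i))"
    by (rule summable_norm[OF sw])
  then have add: "norm (z j + (\<Sum>i. w i)) = norm (z j) + norm (\<Sum>i. w i)"
    using eq[unfolded s1 s2] norm_triangle_ineq[of "z j" "\<Sum>i. w i"] by linarith
  show ?thesis
  proof (cases "(\<Sum>i. w i) = 0")
    case True
    then show ?thesis by (auto simp: s1 intro: exI[of _ 1])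
  next
    case False
    let ?w = "\<Sum>i. w i"
    have "?w = norm ?w *\<^sub>R (?w /\<^sub>R norm ?w)"
      using False by simp
    also have "\<dots> = (norm ?w / norm (z j)) *\<^sub>R z j"
      using strictly_convex_norm_add_eq[OF sc add nz False] by (metis scaleR_scaleR divide_inverse)
    finally have "(\<Sum>i. z i) = (1 + norm ?w / norm (z j)) *\<^sub>R z j"
      by (simp add: s1 scaleR_left_distrib)
    then show ?thesis by blast
  qed
qed

section \<open>Greedy expansions\<close>

text \<open>The condition \<open>d \<noteq> 0\<close> matters for integrability later: for
  \<open>d = 0\<close> the inequality holds at every point, and the set where the step is taken
  could have infinite measure.\<close>

definition good_step :: "real \<Rightarrow> 'b::real_normed_vector \<Rightarrow> 'b \<Rightarrow> bool" where
  "good_step q d r \<longleftrightarrow> d \<noteq> 0 \<and> q * norm d \<le> norm r - norm (r - d)"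

primrec residual :: "(nat \<Rightarrow> 'b::real_normed_vector) \<Rightarrow> real \<Rightarrow> 'b \<Rightarrow> nat \<Rightarrow> 'b" where
  "residual d q x 0 = x"
| "residual d q x (Suc m) =
     (if good_step q (d m) (residual d q x m) then residual d q x m - d m else residual d q x m)"

definition greedy_term :: "(nat \<Rightarrow> 'b::real_normed_vector) \<Rightarrow> real \<Rightarrow> 'b \<Rightarrow> nat \<Rightarrow> 'b" where
  "greedy_term d q x m = (if good_step q (d m) (residual d q x m) then d m else 0)"

lemma residual_eq: "residual d q x n = x - (\<Sum>m<n. greedy_term d q x m)"
  by (induction n) (auto simp: greedy_term_def)

text \<open>Telescoping: an accepted step lowers the norm of the residual by at least
  \<open>q\<close> times the norm of the subtracted term, and a rejected step changes
  nothing.\<close>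

lemma sum_greedy_term_le:
  "q * (\<Sum>m<n. norm (greedy_term d q x m)) + norm (residual d q x n) \<le> norm x"
proof (induction n)
  case (Suc n)
  show ?case
  proof (cases "good_step q (d n) (residual d q x n)")
    case True
    then show ?thesis
      using Suc unfolding good_step_def greedy_term_def by (simp add: distrib_left good_step_def)
  next
    case False
    then show ?thesis using Suc by (simp add: greedy_term_def)
  qed
qed simp

lemma norm_residual_le:
  assumes "q \<ge> 0"
  shows "norm (residual d q x n) \<le> norm x"
proof -
  have "0 \<le> q * (\<Sum>m<n. norm (greedy_term d q x m))"
    using assms by (intro mult_nonneg_nonneg sum_nonneg) auto
  then show ?thesis using sum_greedy_term_le[of q d x n] by linarith
qed

lemma greedy_term_summable:
  assumes "q > 0"
  shows "summable (\<lambda>m. norm (greedy_term d q x m))"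
proof -
  have b: "(\<Sum>m<n. norm (greedy_term d q x m)) \<le> norm x / q" for n
  proof -
    have "q * (\<Sum>m<n. norm (greedy_term d q x m)) \<le> norm x"
      using sum_greedy_term_le[of q d x n] norm_ge_zero[of "residual d q x n"] by linarith
    then show ?thesis using assms by (simp add: field_simps)
  qed
  then show ?thesis
    by (intro summableI_nonneg_bounded[where x = "norm x / q"]) auto
qed

text \<open>If the residuals had a nonzero limit \<open>r\<close>, an element \<open>g\<close> of the group close to \<open>r\<close> would be
  subtracted infinitely often, which forces \<open>r = r - g\<close>.\<close>

lemma residual_tendsto_0:
  fixes d :: "nat \<Rightarrow> 'b::banach"
  assumes q: "0 < q" "q < 1"
    and diff: "\<And>g h. g \<in> G \<Longrightarrow> h \<in> G \<Longrightarrow> g - h \<in> G"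
    and d: "range d \<subseteq> G"
    and inf: "\<And>g. g \<in> G \<Longrightarrow> infinite {m. d m = g}"
    and x: "x \<in> closure G"
  shows "residual d q x \<longlonglongrightarrow> 0"
proof -
  let ?r = "residual d q x"
  have "summable (greedy_term d q x)"
    by (rule summable_norm_cancel[OF greedy_term_summable[OF q(1)]])
  then have "(\<lambda>n. x - (\<Sum>m<n. greedy_term d q x m)) \<longlonglongrightarrow> x - (\<Sum>m. greedy_term d q x m)"
    by (intro tendsto_diff tendsto_const summable_LIMSEQ)
  then have "?r \<longlonglongrightarrow> x - (\<Sum>m. greedy_term d q x m)"
    by (simp add: residual_eq[symmetric])
  then obtain r where r: "?r \<longlonglongrightarrow> r" by blast
  have "r = 0"
  proof (rule ccontr)
    assume nz: "r \<noteq> 0"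
    \<comment> \<open>Subtracting \<open>d m\<close> maps \<open>G\<close> into itself, hence its
      closure too. So the limit \<open>r\<close> can be approximated by elements of
      \<open>G\<close>.\<close>
    have "?r m \<in> closure G" for m
    proof (induction m)
      case (Suc m)
      have "(\<lambda>y. y - d m) ` closure G \<subseteq> closure G"
        by (rule image_closure_subset)
          (use d diff in \<open>auto intro!: continuous_intros subsetD[OF closure_subset]\<close>)
      then show ?case using Suc by auto
    qed (simp add: x)
    then have "r \<in> closure G"
      using r closed_closure by (metis closed_sequentially)
    \<comment> \<open>With this \<open>e\<close>, \<open>norm (r - g) < e\<close> yields \<open>q *
      norm g + norm (r - g) \<le> q * norm r + 2 * norm (r - g) < norm r\<close>. Thus subtracting
      \<open>g\<close> is a good step at \<open>r\<close>, with strict inequality, and therefore at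
      all late residuals. Also \<open>e < norm r\<close> keeps \<open>g\<close> away from 0.\<close>
    define e where "e = (1 - q) * norm r / 2"
    have "e > 0" using q nz by (simp add: e_def)
    then obtain g where g: "g \<in> G" "dist g r < e"
      using \<open>r \<in> closure G\<close> by (meson closure_approachable)
    have rg: "norm (r - g) < e" using g(2) by (simp add: dist_norm norm_minus_commute)
    have "norm r \<le> norm g + norm (r - g)"
      by (metis add.commute norm_triangle_sub)
    moreover have "e < norm r"
    proof -
      have "(1 - q) * norm r \<le> 1 * norm r"
        using q by (intro mult_right_mono) auto
      moreover have "norm r > 0" using nz by simp
      ultimately show ?thesis unfolding e_def by linarith
    qed
    ultimately have "g \<noteq> 0" using rg by auto
    have "norm g \<le> norm r + norm (r - g)"
      by (metis norm_minus_commute norm_triangle_sub)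
    then have "q * norm g \<le> q * norm r + q * norm (r - g)"
      using q by (metis distrib_left mult_left_mono less_imp_le)
    moreover have "q * norm (r - g) \<le> norm (r - g)"
      using q by (simp add: mult_left_le_one_le)
    moreover have "2 * e = norm r - q * norm r"
      by (simp add: e_def left_diff_distrib)
    ultimately have "q * norm g < norm r - norm (r - g)"
      using rg by linarith
    moreover have "(\<lambda>m. norm (?r m) - norm (?r m - g)) \<longlonglongrightarrow> norm r - norm (r - g)"
      by (intro tendsto_intros r)
    ultimately have "\<forall>\<^sub>F m in sequentially. q * norm g < norm (?r m) - norm (?r m - g)"
      by (rule order_tendstoD(1)[rotated])
    moreover have "\<forall>\<^sub>F m in sequentially. norm (?r (Suc m) - ?r m) < norm g"
    proof -
      have "(\<lambda>m. norm (?r (Suc m) - ?r m)) \<longlonglongrightarrow> norm (r - r)"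
        using r by (intro tendsto_intros LIMSEQ_Suc)
      then show ?thesis
        by (rule order_tendstoD(2)) (simp add: \<open>g \<noteq> 0\<close>)
    qed
    \<comment> \<open>A late index with \<open>d m = g\<close> would trigger a step of length
      \<open>norm g\<close>, longer than the increments still are.\<close>
    ultimately have "\<forall>\<^sub>F m in sequentially. d m \<noteq> g"
      by eventually_elim (auto simp: good_step_def \<open>g \<noteq> 0\<close> split: if_splits)
    then show False
      using inf[OF g(1)] by (simp add: cofinite_eq_sequentially[symmetric] eventually_cofinite)
  qed
  then show ?thesis using r by simp
qed

lemma greedy_sequence_exists:
  fixes S :: "'b::banach set"
  assumes "countable S"
  shows "\<exists>d. \<forall>q. 0 < q \<and> q < 1 \<longrightarrow> (\<forall>x\<in>closure S. residual d q x \<longlonglongrightarrow> 0)"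
proof -
  \<comment> \<open>The additive group generated by \<open>S\<close>, written as differences of list
    sums so that countability is inherited from \<open>lists S\<close>.\<close>
  define G where "G = (\<lambda>(xs, ys). sum_list xs - sum_list ys) ` (lists S \<times> lists S)"
  have "countable G"
    unfolding G_def using assms by (intro countable_image countable_SIGMA) auto
  have "([], []) \<in> lists S \<times> lists S" by simp
  then have "G \<noteq> {}" unfolding G_def by blast
  have diff: "g - h \<in> G" if gh: "g \<in> G" "h \<in> G" for g h
  proof -
    obtain a b a' b' where ab: "a \<in> lists S" "b \<in> lists S" "a' \<in> lists S" "b' \<in> lists S"
      and "g = sum_list a - sum_list b" "h = sum_list a' - sum_list b'"
      using gh unfolding G_def by auto
    then have "g - h = sum_list (a @ b') - sum_list (b @ a')" by simp
    moreover have "(a @ b', b @ a') \<in> lists S \<times> lists S" using ab by auto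
    ultimately show ?thesis unfolding G_def by (intro rev_image_eqI[of "(a @ b', b @ a')"]) simp_all
  qed
  have "S \<subseteq> G"
  proof
    fix s assume "s \<in> S"
    then have "([s], []) \<in> lists S \<times> lists S" by simp
    then show "s \<in> G" unfolding G_def by (rule rev_image_eqI) simp
  qed
  \<comment> \<open>The second component of the decoded pair is dropped, so every element of
    \<open>G\<close> recurs infinitely often. The sequence does not depend on
    \<open>q\<close>.\<close>
  define d where "d m = from_nat_into G (fst (prod_decode m))" for m
  have "range d \<subseteq> G"
    unfolding d_def using from_nat_into[OF \<open>G \<noteq> {}\<close>] by auto
  have inf: "infinite {m. d m = g}" if g: "g \<in> G" for g
  proof -
    obtain n where n: "from_nat_into G n = g"
      using from_nat_into_surj[OF \<open>countable G\<close> g] by blast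
    have "range (\<lambda>k. prod_encode (n, k)) \<subseteq> {m. d m = g}"
      by (auto simp: d_def n)
    moreover have "infinite (range (\<lambda>k. prod_encode (n, k)))"
      by (intro range_inj_infinite injI) auto
    ultimately show ?thesis by (meson finite_subset)
  qed
  show ?thesis
  proof (intro exI allI impI ballI)
    fix q :: real and x assume "0 < q \<and> q < 1" "x \<in> closure S"
    then show "residual d q x \<longlonglongrightarrow> 0"
      using residual_tendsto_0[OF _ _ diff \<open>range d \<subseteq> G\<close> inf, of q x]
        closure_mono[OF \<open>S \<subseteq> G\<close>] by auto
  qed
qed

section \<open>Strong measurability\<close>

text \<open>The measurability half of \<open>bochner_L1\<close>. In a nonseparable space the
  difference of two Borel functions need not be Borel, whereas approximating simple functions can be
  subtracted.\<close>

definition strongly_measurable :: "'a measure \<Rightarrow> ('a \<Rightarrow> 'b::topological_space) \<Rightarrow> bool" where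
  "strongly_measurable M u \<longleftrightarrow>
     (\<exists>s. (\<forall>n. simple_function M (s n)) \<and> (\<forall>\<omega>\<in>space M. (\<lambda>n. s n \<omega>) \<longlonglongrightarrow> u \<omega>))"

lemma strongly_measurable_imp_borel_measurable:
  fixes u :: "'a \<Rightarrow> 'b::metric_space"
  assumes "strongly_measurable M u"
  shows "u \<in> borel_measurable M"
proof -
  obtain s where s: "\<And>n. simple_function M (s n)" "\<And>\<omega>. \<omega> \<in> space M \<Longrightarrow> (\<lambda>n. s n \<omega>) \<longlonglongrightarrow> u \<omega>"
    using assms unfolding strongly_measurable_def by blast
  show ?thesis
    by (rule borel_measurable_LIMSEQ_metric[OF borel_measurable_simple_function[OF s(1)] s(2)])
qed

lemma borel_measurable_imp_strongly_measurable:
  fixes f :: "'a \<Rightarrow> 'b::{metric_space, second_countable_topology}"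
  assumes "f \<in> borel_measurable M"
  shows "strongly_measurable M f"
  using borel_measurable_implies_sequence_metric[OF assms, of undefined]
  unfolding strongly_measurable_def by blast

lemma strongly_measurable_compose:
  assumes "strongly_measurable M u" and "continuous_on UNIV h"
  shows "strongly_measurable M (\<lambda>\<omega>. h (u \<omega>))"
proof -
  obtain s where s: "\<And>n. simple_function M (s n)" "\<And>\<omega>. \<omega> \<in> space M \<Longrightarrow> (\<lambda>n. s n \<omega>) \<longlonglongrightarrow> u \<omega>"
    using assms(1) unfolding strongly_measurable_def by blast
  show ?thesis
    unfolding strongly_measurable_def
    using simple_function_compose1[OF s(1), of h] continuous_on_tendsto_compose[OF assms(2) s(2)]
    by (intro exI[of _ "\<lambda>n \<omega>. h (s n \<omega>)"]) simp
qed

lemma strongly_measurable_diff: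
  fixes u v :: "'a \<Rightarrow> 'b::real_normed_vector"
  assumes "strongly_measurable M u" "strongly_measurable M v"
  shows "strongly_measurable M (\<lambda>\<omega>. u \<omega> - v \<omega>)"
proof -
  obtain s t where s: "\<And>n. simple_function M (s n)" "\<And>\<omega>. \<omega> \<in> space M \<Longrightarrow> (\<lambda>n. s n \<omega>) \<longlonglongrightarrow> u \<omega>"
    and t: "\<And>n. simple_function M (t n)" "\<And>\<omega>. \<omega> \<in> space M \<Longrightarrow> (\<lambda>n. t n \<omega>) \<longlonglongrightarrow> v \<omega>"
    using assms unfolding strongly_measurable_def by blast
  show ?thesis
    unfolding strongly_measurable_def
    using simple_function_compose2[OF s(1) t(1), of "(-)"] tendsto_diff[OF s(2) t(2)]
    by (intro exI[of _ "\<lambda>n \<omega>. s n \<omega> - t n \<omega>"]) simp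
qed

text \<open>The union of the finite ranges of the approximating simple functions serves as
  \<open>S\<close>. It supplies the countable set from which greedy expansions are built.\<close>

lemma strongly_measurable_closure:
  assumes "strongly_measurable M u"
  shows "\<exists>S. countable S \<and> u ` space M \<subseteq> closure S"
proof -
  obtain s where s: "\<And>n. simple_function M (s n)" "\<And>\<omega>. \<omega> \<in> space M \<Longrightarrow> (\<lambda>n. s n \<omega>) \<longlonglongrightarrow> u \<omega>"
    using assms unfolding strongly_measurable_def by blast
  let ?S = "\<Union>n. s n ` space M"
  have "countable ?S"
    using simple_functionD(1)[OF s(1)] by (intro countable_UN) (auto intro: countable_finite)
  moreover have "u ` space M \<subseteq> closure ?S"
  proof
    fix v assume "v \<in> u ` space M"
    then obtain \<omega> where w: "\<omega> \<in> space M" "v = u \<omega>" by blast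
    then have "s n \<omega> \<in> closure ?S" for n
      by (intro subsetD[OF closure_subset]) blast
    then show "v \<in> closure ?S"
      using Lim_in_closed_set[OF closed_closure _ _ s(2)[OF w(1)]] w(2) by simp
  qed
  ultimately show ?thesis by (intro exI[of _ ?S] conjI)
qed

section \<open>Series of elementary tensors\<close>

lemma bochner_L1D:
  assumes "bochner_L1 M u"
  shows "strongly_measurable M u"
    and "u \<in> borel_measurable M"
    and "integrable M (\<lambda>\<omega>. norm (u \<omega>))"
    and "(\<integral>\<^sup>+\<omega>. ennreal (norm (u \<omega>)) \<partial>M) = ennreal (L1_norm M u)"
proof -
  show s: "strongly_measurable M u"
    using assms unfolding bochner_L1_def strongly_measurable_def by blast
  then show u: "u \<in> borel_measurable M"
    by (rule strongly_measurable_imp_borel_measurable)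
  show i: "integrable M (\<lambda>\<omega>. norm (u \<omega>))"
    using assms borel_measurable_continuous_on[OF continuous_on_norm_id u]
    unfolding bochner_L1_def by (intro integrableI_bounded) auto
  show "(\<integral>\<^sup>+\<omega>. ennreal (norm (u \<omega>)) \<partial>M) = ennreal (L1_norm M u)"
    unfolding L1_norm_def using i by (intro nn_integral_eq_integral) auto
qed

lemma L1_norm_nonneg: "0 \<le> L1_norm M u"
  unfolding L1_norm_def by simp

context banach_space_over
begin

abbreviation term_norm :: "'a measure \<Rightarrow> (nat \<Rightarrow> 'a \<Rightarrow> 'k) \<Rightarrow> (nat \<Rightarrow> 'b) \<Rightarrow> nat \<Rightarrow> real" where
  "term_norm M f y i \<equiv> L1_norm M (f i) * norm (y i)"

lemma bounded_linear_scl: "bounded_linear (\<lambda>c. scl c y)"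
proof (rule bounded_linear_intro[where K = "norm y"])
  show "scl (r *\<^sub>R c) y = r *\<^sub>R scl c y" for r c
    by (metis scaleR_conv_of_real scale_of_real scale_scale)
qed (simp_all add: scale_left_distrib norm_scale)

lemma norm_scl_diff: "norm (scl c y - scl c' y) = norm (c - c') * norm y"
  by (metis norm_scale scale_left_diff_distrib)

lemma nn_integral_norm_tensor:
  assumes "integrable M f"
  shows "(\<integral>\<^sup>+\<omega>. ennreal (norm (tensor scl f y \<omega>)) \<partial>M) = ennreal (L1_norm M f * norm y)"
proof -
  have "integrable M (\<lambda>\<omega>. norm (f \<omega>) * norm y)" using assms by simp
  then show ?thesis
    unfolding tensor_def norm_scale L1_norm_def
    by (subst nn_integral_eq_integral) auto
qed

lemma tensor_measurable:
  assumes "integrable M f"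
  shows "tensor scl f y \<in> borel_measurable M"
  unfolding tensor_def
  by (rule borel_measurable_continuous_on)
    (use assms bounded_linear.continuous_on[OF bounded_linear_scl continuous_on_id] in auto)

lemma norm_tensor_measurable [measurable]:
  assumes "integrable M f"
  shows "(\<lambda>\<omega>. norm (tensor scl f y \<omega>)) \<in> borel_measurable M"
  by (rule borel_measurable_continuous_on[OF continuous_on_norm_id tensor_measurable[OF assms]])

text \<open>Scalars are second countable, so each \<open>f i\<close> is strongly measurable.
  Composition with the continuous map \<open>\<lambda>c. scl c (y i)\<close> and subtraction
  preserve this.\<close>

lemma strongly_measurable_remainder:
  fixes f :: "nat \<Rightarrow> 'a \<Rightarrow> 'k"
  assumes "strongly_measurable M u" and f: "\<And>i. integrable M (f i)"
  shows "strongly_measurable M (\<lambda>\<omega>. u \<omega> - (\<Sum>i<n. tensor scl (f i) (y i) \<omega>))"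
proof (induction n)
  case 0
  then show ?case using assms(1) by simp
next
  case (Suc n)
  have "strongly_measurable M (\<lambda>\<omega>. scl (f n \<omega>) (y n))"
    using borel_measurable_imp_strongly_measurable[of "f n" M] f[of n]
      bounded_linear.continuous_on[OF bounded_linear_scl continuous_on_id]
    by (intro strongly_measurable_compose[where h = "\<lambda>c. scl c (y n)"]) auto
  from strongly_measurable_diff[OF Suc this] show ?case
    by (simp add: tensor_def algebra_simps)
qed

lemma norm_remainder_measurable:
  fixes f :: "nat \<Rightarrow> 'a \<Rightarrow> 'k"
  assumes "strongly_measurable M u" and "\<And>i. integrable M (f i)"
  shows "(\<lambda>\<omega>. norm (u \<omega> - (\<Sum>i<n. tensor scl (f i) (y i) \<omega>))) \<in> borel_measurable M"
  by (rule borel_measurable_continuous_on[OF continuous_on_norm_id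
        strongly_measurable_imp_borel_measurable[OF strongly_measurable_remainder[OF assms]]])

text \<open>Dominated convergence for the norms of the remainders, with
  \<open>norm (u \<omega>)\<close> as majorant.\<close>

lemma tensor_sumsI:
  assumes u: "bochner_L1 M u" and f: "\<And>i. integrable M (f i)"
    and lim: "AE \<omega> in M. (\<lambda>n. \<Sum>i<n. tensor scl (f i) (y i) \<omega>) \<longlonglongrightarrow> u \<omega>"
    and bound: "\<And>n \<omega>. \<omega> \<in> space M \<Longrightarrow> norm (u \<omega> - (\<Sum>i<n. tensor scl (f i) (y i) \<omega>)) \<le> norm (u \<omega>)"
  shows "tensor_sums M scl f y u"
proof -
  let ?r = "\<lambda>n \<omega>. norm (u \<omega> - (\<Sum>i<n. tensor scl (f i) (y i) \<omega>))"
  have r: "?r n \<in> borel_measurable M" for n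
    using norm_remainder_measurable[OF bochner_L1D(1)[OF u] f] .
  have "(\<lambda>n. \<integral>\<^sup>+\<omega>. ennreal (?r n \<omega>) \<partial>M) \<longlonglongrightarrow> (\<integral>\<^sup>+\<omega>. 0 \<partial>M)"
  proof (rule nn_integral_dominated_convergence[where w = "\<lambda>\<omega>. ennreal (norm (u \<omega>))"])
    show "(\<lambda>\<omega>. ennreal (?r n \<omega>)) \<in> borel_measurable M" for n
      using r by measurable
    show "(\<lambda>\<omega>. ennreal (norm (u \<omega>))) \<in> borel_measurable M"
      using bochner_L1D(3)[OF u] by measurable
    show "(\<integral>\<^sup>+\<omega>. ennreal (norm (u \<omega>)) \<partial>M) < \<infinity>"
      using u by (simp add: bochner_L1_def)
    show "AE \<omega> in M. ennreal (?r n \<omega>) \<le> ennreal (norm (u \<omega>))" for n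
      using bound by (intro AE_I2 ennreal_leI)
    show "AE \<omega> in M. (\<lambda>n. ennreal (?r n \<omega>)) \<longlonglongrightarrow> 0"
      using lim
    proof eventually_elim
      case (elim \<omega>)
      have "(\<lambda>n. ?r n \<omega>) \<longlonglongrightarrow> norm (u \<omega> - u \<omega>)"
        by (intro tendsto_intros elim)
      then show ?case using tendsto_ennrealI by fastforce
    qed
  qed simp
  then show ?thesis unfolding tensor_sums_def using f by simp
qed

lemma nn_integral_suminf_norm_tensor:
  assumes f: "\<And>i. integrable M (f i)" and sm: "summable (term_norm M f y)"
  shows "(\<integral>\<^sup>+\<omega>. (\<Sum>i. ennreal (norm (tensor scl (f i) (y i) \<omega>))) \<partial>M)
    = ennreal (\<Sum>i. term_norm M f y i)"
proof -
  have "(\<integral>\<^sup>+\<omega>. (\<Sum>i. ennreal (norm (tensor scl (f i) (y i) \<omega>))) \<partial>M)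
      = (\<Sum>i. ennreal (term_norm M f y i))"
    using f by (subst nn_integral_suminf) (auto simp: nn_integral_norm_tensor)
  also have "\<dots> = ennreal (\<Sum>i. term_norm M f y i)"
    by (intro suminf_ennreal2 sm) (simp add: L1_norm_nonneg)
  finally show ?thesis .
qed

text \<open>Finiteness of the integrated series of norms makes the pointwise series absolutely
  convergent almost everywhere. Fatou's lemma makes the lower limit of the remainder norms vanish
  almost everywhere. Where both hold, the remainders converge, so their limit is 0 and the pointwise
  sum is \<open>u \<omega>\<close>.\<close>

lemma tensor_sums_AE:
  assumes u: "bochner_L1 M u" and ts: "tensor_sums M scl f y u"
    and sm: "summable (term_norm M f y)"
  shows "AE \<omega> in M. summable (\<lambda>i. norm (tensor scl (f i) (y i) \<omega>)) \<and>
    u \<omega> = (\<Sum>i. tensor scl (f i) (y i) \<omega>)"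
proof -
  let ?t = "\<lambda>i. tensor scl (f i) (y i)"
  let ?r = "\<lambda>n \<omega>. norm (u \<omega> - (\<Sum>i<n. ?t i \<omega>))"
  have f: "\<And>i. integrable M (f i)" using ts by (simp add: tensor_sums_def)
  have "(\<integral>\<^sup>+\<omega>. (\<Sum>i. ennreal (norm (?t i \<omega>))) \<partial>M) \<noteq> \<infinity>"
    by (simp add: nn_integral_suminf_norm_tensor[OF f sm])
  then have "AE \<omega> in M. (\<Sum>i. ennreal (norm (?t i \<omega>))) \<noteq> \<infinity>"
    using f by (intro nn_integral_PInf_AE) auto
  moreover have "AE \<omega> in M. liminf (\<lambda>n. ennreal (?r n \<omega>)) = 0"
  proof -
    have r: "?r n \<in> borel_measurable M" for n
      using norm_remainder_measurable[OF bochner_L1D(1)[OF u] f] .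
    then have m: "(\<lambda>\<omega>. ennreal (?r n \<omega>)) \<in> borel_measurable M" for n by measurable
    have "(\<integral>\<^sup>+\<omega>. liminf (\<lambda>n. ennreal (?r n \<omega>)) \<partial>M) \<le> liminf (\<lambda>n. \<integral>\<^sup>+\<omega>. ennreal (?r n \<omega>) \<partial>M)"
      by (rule nn_integral_liminf[OF m])
    also have "\<dots> = 0"
      using ts by (intro lim_imp_Liminf) (auto simp: tensor_sums_def)
    finally show ?thesis
      using m by (subst nn_integral_0_iff_AE[symmetric]) auto
  qed
  ultimately show ?thesis
  proof eventually_elim
    case (elim \<omega>)
    have s: "summable (\<lambda>i. norm (?t i \<omega>))"
      using elim(1) by (intro summable_suminf_not_top) auto
    have "(\<lambda>n. ?r n \<omega>) \<longlonglongrightarrow> norm (u \<omega> - (\<Sum>i. ?t i \<omega>))"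
      by (intro tendsto_intros summable_LIMSEQ summable_norm_cancel[OF s])
    then have "(\<lambda>n. ennreal (?r n \<omega>)) \<longlonglongrightarrow> ennreal (norm (u \<omega> - (\<Sum>i. ?t i \<omega>)))"
      by (rule tendsto_ennrealI)
    then have "liminf (\<lambda>n. ennreal (?r n \<omega>)) = ennreal (norm (u \<omega> - (\<Sum>i. ?t i \<omega>)))"
      by (intro lim_imp_Liminf) auto
    then show ?case using elim(2) s by auto
  qed
qed

section \<open>The projective norm computed as the integral of the pointwise norm\<close>

lemma L1_norm_le_suminf:
  assumes u: "bochner_L1 M u" and ts: "tensor_sums M scl f y u"
    and sm: "summable (term_norm M f y)"
  shows "L1_norm M u \<le> (\<Sum>i. term_norm M f y i)"
proof -
  have f: "\<And>i. integrable M (f i)" using ts by (simp add: tensor_sums_def)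
  have "(\<integral>\<^sup>+\<omega>. ennreal (norm (u \<omega>)) \<partial>M) \<le>
      (\<integral>\<^sup>+\<omega>. (\<Sum>i. ennreal (norm (tensor scl (f i) (y i) \<omega>))) \<partial>M)"
  proof (rule nn_integral_mono_AE)
    show "AE \<omega> in M. ennreal (norm (u \<omega>)) \<le> (\<Sum>i. ennreal (norm (tensor scl (f i) (y i) \<omega>)))"
      using tensor_sums_AE[OF assms]
    proof eventually_elim
      case (elim \<omega>)
      then show ?case
        by (auto simp: suminf_ennreal2 intro!: ennreal_leI summable_norm)
    qed
  qed
  moreover have "0 \<le> (\<Sum>i. term_norm M f y i)"
    by (intro suminf_nonneg sm) (simp add: L1_norm_nonneg)
  ultimately show ?thesis
    by (simp add: nn_integral_suminf_norm_tensor[OF f sm] bochner_L1D(4)[OF u])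
qed

text \<open>The greedy expansion is run at each \<open>u \<omega>\<close> with one common sequence
  \<open>d\<close>. Only the acceptance of step \<open>m\<close> depends on \<open>\<omega>\<close>,
  so the \<open>m\<close>-th term is the elementary tensor of the indicator of the acceptance set
  \<open>A m\<close> with \<open>d m\<close>. Integrating the telescoping bound gives the
  cost.\<close>

lemma tensor_sums_approx:
  assumes u: "bochner_L1 M u" and q: "0 < q" "q < 1"
  shows "\<exists>f y. tensor_sums M scl f y u \<and> summable (term_norm M f y) \<and>
    q * (\<Sum>i. term_norm M f y i) \<le> L1_norm M u"
proof -
  note [measurable] = bochner_L1D(2)[OF u]
  obtain S where S: "countable S" "u ` space M \<subseteq> closure S"
    using strongly_measurable_closure[OF bochner_L1D(1)[OF u]] by blast
  obtain d where d: "\<And>x. x \<in> closure S \<Longrightarrow> residual d q x \<longlonglongrightarrow> 0"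
    using greedy_sequence_exists[OF S(1)] q by blast
  let ?r = "\<lambda>m \<omega>. residual d q (u \<omega>) m"
  define A where "A m = {\<omega>\<in>space M. good_step q (d m) (?r m \<omega>)}" for m
  have step: "{\<omega>\<in>space M. good_step q (d m) (v \<omega>)} \<in> sets M"
    if v: "v \<in> borel_measurable M" for v m
  proof -
    \<comment> \<open>The whole difference is one continuous real function of
      \<open>v \<omega>\<close>, so Borel measurability of \<open>v\<close> suffices.\<close>
    have [measurable]: "(\<lambda>\<omega>. norm (v \<omega>) - norm (v \<omega> - d m)) \<in> borel_measurable M"
      by (rule borel_measurable_continuous_on[OF _ v]) (intro continuous_intros)
    show ?thesis unfolding good_step_def by measurable
  qed
  have r: "?r m \<in> borel_measurable M" for m
  proof (induction m)
    case (Suc m)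
    have "(\<lambda>\<omega>. ?r m \<omega> - d m) \<in> borel_measurable M"
      by (rule borel_measurable_continuous_on[OF _ Suc]) (intro continuous_intros)
    then show ?case
      by (simp only: residual.simps) (intro measurable_If Suc step)
  qed simp
  have A: "A m \<in> sets M" for m
    unfolding A_def by (rule step[OF r])
  define f where "f m \<omega> = (of_real (indicator (A m) \<omega>) :: 'k)" for m \<omega>
  have t: "tensor scl (f m) (d m) \<omega> = greedy_term d q (u \<omega>) m" if "\<omega> \<in> space M" for m \<omega>
    using that by (simp add: tensor_def f_def scale_of_real greedy_term_def A_def indicator_def)
  \<comment> \<open>A Markov-type bound: on \<open>A m\<close> the decrease of the residual gives
    \<open>q * norm (d m) \<le> norm (u \<omega>)\<close>. For \<open>d m = 0\<close> the set
    \<open>A m\<close> is empty.\<close>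
  have f: "integrable M (f m)" for m
  proof (cases "d m = 0")
    case True
    then show ?thesis by (simp add: f_def[abs_def] A_def good_step_def)
  next
    case False
    have "integrable M (\<lambda>\<omega>. norm (u \<omega>) / (q * norm (d m)))"
      using bochner_L1D(3)[OF u] by simp
    then show ?thesis
    proof (rule Bochner_Integration.integrable_bound)
      show "f m \<in> borel_measurable M" unfolding f_def using A by measurable
      show "AE \<omega> in M. norm (f m \<omega>) \<le> norm (norm (u \<omega>) / (q * norm (d m)))"
      proof (rule AE_I2)
        fix \<omega> assume w: "\<omega> \<in> space M"
        show "norm (f m \<omega>) \<le> norm (norm (u \<omega>) / (q * norm (d m)))"
        proof (cases "\<omega> \<in> A m")
          case True
          then have "q * norm (d m) \<le> norm (?r m \<omega>) - norm (?r m \<omega> - d m)"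
            by (simp add: A_def good_step_def)
          also have "\<dots> \<le> norm (u \<omega>)"
            using norm_residual_le[of q d "u \<omega>" m] q norm_ge_zero[of "?r m \<omega> - d m"] by linarith
          finally show ?thesis using True False q by (simp add: f_def field_simps)
        qed (simp add: f_def)
      qed
    qed
  qed
  have ts: "tensor_sums M scl f d u"
  proof (rule tensor_sumsI[OF u f])
    have rem: "u \<omega> - (\<Sum>i<n. tensor scl (f i) (d i) \<omega>) = ?r n \<omega>" if "\<omega> \<in> space M" for n \<omega>
      by (simp add: residual_eq t that)
    show "norm (u \<omega> - (\<Sum>i<n. tensor scl (f i) (d i) \<omega>)) \<le> norm (u \<omega>)"
      if "\<omega> \<in> space M" for n \<omega>
      using q that by (simp add: rem norm_residual_le)
    show "AE \<omega> in M. (\<lambda>n. \<Sum>i<n. tensor scl (f i) (d i) \<omega>) \<longlonglongrightarrow> u \<omega>"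
    proof (rule AE_I2)
      fix \<omega> assume w: "\<omega> \<in> space M"
      have "(\<lambda>n. u \<omega> - ?r n \<omega>) \<longlonglongrightarrow> u \<omega> - 0"
        using d S(2) w by (intro tendsto_intros) auto
      then show "(\<lambda>n. \<Sum>i<n. tensor scl (f i) (d i) \<omega>) \<longlonglongrightarrow> u \<omega>"
        by (simp add: rem[OF w, symmetric])
    qed
  qed
  have "q * (\<Sum>i<n. term_norm M f d i) \<le> L1_norm M u" for n
  proof -
    have "q * (\<Sum>i<n. term_norm M f d i) = (\<integral>\<omega>. q * (\<Sum>i<n. norm (f i \<omega>) * norm (d i)) \<partial>M)"
      using f by (simp add: L1_norm_def)
    also have "\<dots> \<le> (\<integral>\<omega>. norm (u \<omega>) \<partial>M)"
    proof (rule integral_mono)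
      fix \<omega> assume w: "\<omega> \<in> space M"
      have "(\<Sum>i<n. norm (f i \<omega>) * norm (d i)) = (\<Sum>i<n. norm (greedy_term d q (u \<omega>) i))"
        by (simp add: t[OF w, symmetric] tensor_def norm_scale)
      moreover have "q * (\<Sum>i<n. norm (greedy_term d q (u \<omega>) i)) \<le> norm (u \<omega>)"
        using sum_greedy_term_le[of q d "u \<omega>" n] norm_ge_zero[of "?r n \<omega>"] by linarith
      ultimately show "q * (\<Sum>i<n. norm (f i \<omega>) * norm (d i)) \<le> norm (u \<omega>)"
        by (simp only:)
    qed (use f bochner_L1D(3)[OF u] in auto)
    finally show ?thesis by (simp add: L1_norm_def)
  qed
  then have b: "(\<Sum>i<n. term_norm M f d i) \<le> L1_norm M u / q" for n
    using q by (simp add: field_simps)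
  have sm: "summable (term_norm M f d)"
    by (rule summableI_nonneg_bounded[OF _ b]) (simp add: L1_norm_nonneg)
  have "(\<Sum>i. term_norm M f d i) \<le> L1_norm M u / q"
    by (rule suminf_le_const[OF sm b])
  then show ?thesis
    using ts sm q by (intro exI[of _ f] exI[of _ d]) (simp add: field_simps)
qed

text \<open>The integrated triangle inequality bounds every representation from below. Greedy
  representations cost at most \<open>L1_norm M u / q\<close>, and letting \<open>q\<close> increase
  to 1 gives the reverse bound.\<close>

theorem projective_norm_eq_L1_norm:
  assumes u: "bochner_L1 M u"
  shows "projective_norm M scl u = L1_norm M u"
proof -
  let ?P = "{(\<Sum>i. term_norm M f y i) | f y. tensor_sums M scl f y u \<and> summable (term_norm M f y)}"
  have lower: "L1_norm M u \<le> p" if "p \<in> ?P" for p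
    using that L1_norm_le_suminf[OF u] by blast
  have q_le: "q * Inf ?P \<le> L1_norm M u" if q: "0 < q" "q < 1" for q
  proof -
    obtain f y where fy: "tensor_sums M scl f y u" "summable (term_norm M f y)"
      "q * (\<Sum>i. term_norm M f y i) \<le> L1_norm M u"
      using tensor_sums_approx[OF u q] by blast
    then have "(\<Sum>i. term_norm M f y i) \<in> ?P" by blast
    then have "Inf ?P \<le> (\<Sum>i. term_norm M f y i)"
      using lower by (intro cInf_lower bdd_belowI)
    then have "q * Inf ?P \<le> q * (\<Sum>i. term_norm M f y i)"
      using q by simp
    with fy(3) show ?thesis by linarith
  qed
  have "?P \<noteq> {}"
    using tensor_sums_approx[OF u, of "1/2"] by auto
  then have "L1_norm M u \<le> Inf ?P"
    using lower by (rule cInf_greatest)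
  moreover have "Inf ?P \<le> L1_norm M u"
  proof (rule tendsto_upperbound)
    show "((\<lambda>q. q * Inf ?P) \<longlongrightarrow> Inf ?P) (at_left 1)"
      by (auto intro!: tendsto_eq_intros)
    show "\<forall>\<^sub>F q in at_left 1. q * Inf ?P \<le> L1_norm M u"
      by (rule eventually_at_leftI[of 0]) (auto intro: q_le)
  qed simp
  ultimately show ?thesis unfolding projective_norm_def by simp
qed

section \<open>Disjointly supported representations\<close>

text \<open>This inverse serves as the coordinate function along \<open>y\<close> on the line
  \<open>span {y}\<close>.\<close>

lemma inv_scl [simp]:
  assumes "y \<noteq> 0"
  shows "inv (\<lambda>c. scl c y) (scl c y) = c"
proof -
  have "inj (\<lambda>c. scl c y)" using assms by (intro injI) simp
  from inv_f_f[OF this, of c] show ?thesis .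
qed

text \<open>For \<open>y \<noteq> 0\<close> the line is the image of the complete scalar field under
  a map that multiplies distances by \<open>norm y\<close>, hence complete.\<close>

lemma closed_span_singleton: "closed (span {y})"
proof (cases "y = 0")
  case False
  have "complete (range (\<lambda>c. scl c y))"
    by (rule complete_isometric_image[of "norm y"])
      (auto simp: False bounded_linear_scl norm_scale complete_UNIV mult.commute)
  then show ?thesis
    by (simp add: span_singleton complete_imp_closed)
qed simp

lemma continuous_on_inv_scl:
  assumes "y \<noteq> 0"
  shows "continuous_on (span {y}) (inv (\<lambda>c. scl c y))"
proof (rule lipschitz_on_continuous_on)
  show "(1 / norm y)-lipschitz_on (span {y}) (inv (\<lambda>c. scl c y))"
    using assms
    by (intro lipschitz_onI) (auto simp: span_singleton dist_norm norm_scl_diff)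
qed

text \<open>The coordinate is continuous only on the line, so the composition is formed on the
  restricted space over \<open>A\<close> and then extended by 0.\<close>

lemma coordinate_measurable:
  assumes "y \<noteq> 0" and u: "u \<in> borel_measurable M" and A: "A \<in> sets M" and uA: "u ` A \<subseteq> span {y}"
  shows "(\<lambda>\<omega>. if \<omega> \<in> A then inv (\<lambda>c. scl c y) (u \<omega>) else 0) \<in> borel_measurable M"
proof (subst measurable_If_restrict_space_iff)
  show "{\<omega> \<in> space M. \<omega> \<in> A} \<in> sets M" using A by measurable
  have "u \<in> measurable (restrict_space M A) (restrict_space borel (span {y}))"
    using uA by (intro measurable_restrict_space2 measurable_restrict_space1 u)
      (auto simp: space_restrict_space)
  from measurable_compose[OF this
      borel_measurable_continuous_on_restrict[OF continuous_on_inv_scl[OF \<open>y \<noteq> 0\<close>]]]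
  show "(\<lambda>\<omega>. inv (\<lambda>c. scl c y) (u \<omega>)) \<in> borel_measurable (restrict_space M {\<omega>. \<omega> \<in> A}) \<and>
      (\<lambda>\<omega>. 0) \<in> borel_measurable (restrict_space M {\<omega>. \<omega> \<notin> A})"
    by simp
qed

lemma spans_imp_disjoint_tensor_sums:
  assumes u: "bochner_L1 M u" and y: "range y \<subseteq> sphere 0 1"
    and null: "{\<omega> \<in> space M. u \<omega> \<notin> (\<Union>n. span {y n})} \<in> null_sets M"
  shows "\<exists>f. tensor_sums M scl f y u \<and>
    (\<forall>i j. i \<noteq> j \<longrightarrow> {\<omega> \<in> space M. f i \<omega> \<noteq> 0} \<inter> {\<omega> \<in> space M. f j \<omega> \<noteq> 0} = {})"
proof -
  note [measurable] = bochner_L1D(2)[OF u]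
  have y1: "norm (y n) = 1" for n using y by (simp add: image_subset_iff)
  then have y0: "y n \<noteq> 0" for n by (metis norm_zero zero_neq_one)
  \<comment> \<open>Taking the first suitable index keeps the sets disjoint even if lines repeat or
    meet at 0.\<close>
  define A where "A n = {\<omega> \<in> space M. u \<omega> \<in> span {y n} \<and> (\<forall>k<n. u \<omega> \<notin> span {y k})}" for n
  have [measurable]: "span {y n} \<in> sets borel" for n
    by (rule borel_closed[OF closed_span_singleton])
  have A: "A n \<in> sets M" for n unfolding A_def by measurable
  have disj: "i = j" if "\<omega> \<in> A i" "\<omega> \<in> A j" for i j \<omega>
    using that unfolding A_def by (cases i j rule: linorder_cases) auto
  define f where "f n \<omega> = (if \<omega> \<in> A n then inv (\<lambda>c. scl c (y n)) (u \<omega>) else 0)" for n \<omega>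
  have t: "tensor scl (f n) (y n) \<omega> = (if \<omega> \<in> A n then u \<omega> else 0)" for n \<omega>
    by (auto simp: tensor_def f_def A_def span_singleton y0)
  have f: "integrable M (f n)" for n
  proof (rule Bochner_Integration.integrable_bound[OF bochner_L1D(3)[OF u]])
    show "f n \<in> borel_measurable M"
      unfolding f_def[abs_def]
      by (rule coordinate_measurable[OF y0 _ A]) (auto simp: A_def bochner_L1D(2)[OF u])
    have "norm (f n \<omega>) = norm (tensor scl (f n) (y n) \<omega>)" for \<omega>
      by (simp add: tensor_def norm_scale y1)
    then show "AE \<omega> in M. norm (f n \<omega>) \<le> norm (norm (u \<omega>))"
      by (simp add: t)
  qed
  have sum: "(\<Sum>i<n. tensor scl (f i) (y i) \<omega>) = (if m < n then u \<omega> else 0)"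
    if "\<omega> \<in> A m" for n m \<omega>
  proof -
    have "tensor scl (f i) (y i) \<omega> = (if i = m then u \<omega> else 0)" for i
      using that disj by (auto simp: t)
    then show ?thesis by simp
  qed
  have "tensor_sums M scl f y u"
  proof (rule tensor_sumsI[OF u f])
    fix n \<omega>
    show "norm (u \<omega> - (\<Sum>i<n. tensor scl (f i) (y i) \<omega>)) \<le> norm (u \<omega>)"
    proof (cases "\<exists>m. \<omega> \<in> A m")
      case True
      then show ?thesis by (auto simp: sum)
    qed (simp add: t)
  next
    show "AE \<omega> in M. (\<lambda>n. \<Sum>i<n. tensor scl (f i) (y i) \<omega>) \<longlonglongrightarrow> u \<omega>"
      using AE_not_in[OF null] AE_space
    proof eventually_elim
      case (elim \<omega>)
      then have ex: "\<exists>n. u \<omega> \<in> span {y n}" by auto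
      \<comment> \<open>Past this index the partial sums at \<open>\<omega>\<close> are constantly
        \<open>u \<omega>\<close>.\<close>
      define m where "m = (LEAST n. u \<omega> \<in> span {y n})"
      have m: "\<omega> \<in> A m"
        using LeastI_ex[OF ex] not_less_Least elim(2) unfolding A_def m_def by auto
      show ?case
        by (rule tendsto_eventually, rule eventually_mono[OF eventually_gt_at_top[of m]])
          (simp add: sum[OF m])
    qed
  qed
  moreover have "{\<omega> \<in> space M. f i \<omega> \<noteq> 0} \<inter> {\<omega> \<in> space M. f j \<omega> \<noteq> 0} = {}" if "i \<noteq> j" for i j
    using that disj by (auto simp: f_def)
  ultimately show ?thesis by blast
qed

text \<open>At almost every point at most one term is nonzero, so the norm of a partial sum is the
  sum of the norms. Integration bounds the partial sums of the cost by \<open>L1_norm M u\<close>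
  plus an error tending to 0. This yields summability as well as the upper bound;
  \<open>L1_norm_le_suminf\<close> is the other inequality.\<close>

lemma disjoint_tensor_sums_imp_sums_L1_norm:
  assumes u: "bochner_L1 M u" and ts: "tensor_sums M scl f y u"
    and disj: "\<And>i j. i \<noteq> j \<Longrightarrow>
      {\<omega> \<in> space M. f i \<omega> \<noteq> 0} \<inter> {\<omega> \<in> space M. f j \<omega> \<noteq> 0} \<in> null_sets M"
  shows "term_norm M f y sums L1_norm M u"
proof -
  let ?t = "\<lambda>i. tensor scl (f i) (y i)"
  let ?e = "\<lambda>n. \<integral>\<^sup>+\<omega>. ennreal (norm (u \<omega> - (\<Sum>i<n. ?t i \<omega>))) \<partial>M"
  have f: "\<And>i. integrable M (f i)" and e: "?e \<longlonglongrightarrow> 0"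
    using ts by (auto simp: tensor_sums_def)
  have "AE \<omega> in M. i \<noteq> j \<longrightarrow> f i \<omega> = 0 \<or> f j \<omega> = 0" for i j
  proof (cases "i = j")
    case False
    show ?thesis
      using AE_not_in[OF disj[OF False]] AE_space by eventually_elim auto
  qed simp
  then have "AE \<omega> in M. \<forall>i j. i \<noteq> j \<longrightarrow> f i \<omega> = 0 \<or> f j \<omega> = 0"
    by (simp add: AE_all_countable)
  then have norm_sum: "AE \<omega> in M. \<forall>n. norm (\<Sum>i<n. ?t i \<omega>) = (\<Sum>i<n. norm (?t i \<omega>))"
  proof eventually_elim
    case (elim \<omega>)
    show ?case
    proof (cases "\<exists>m. f m \<omega> \<noteq> 0")
      case True
      then obtain m where "f m \<omega> \<noteq> 0" by blast
      define w where "w = ?t m \<omega>"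
      have "?t i \<omega> = (if i = m then w else 0)" for i
        using elim \<open>f m \<omega> \<noteq> 0\<close> by (auto simp: tensor_def w_def)
      then show ?thesis by (simp add: if_distrib[of norm] cong: if_cong)
    qed (simp add: tensor_def)
  qed
  have partial: "ennreal (\<Sum>i<n. term_norm M f y i) \<le> ennreal (L1_norm M u) + ?e n" for n
  proof -
    have r: "(\<lambda>\<omega>. norm (u \<omega> - (\<Sum>i<n. ?t i \<omega>))) \<in> borel_measurable M"
      by (rule norm_remainder_measurable[OF bochner_L1D(1)[OF u] f])
    have "ennreal (\<Sum>i<n. term_norm M f y i) = (\<Sum>i<n. \<integral>\<^sup>+\<omega>. ennreal (norm (?t i \<omega>)) \<partial>M)"
      by (simp add: nn_integral_norm_tensor f sum_ennreal L1_norm_nonneg)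
    also have "\<dots> = (\<integral>\<^sup>+\<omega>. (\<Sum>i<n. ennreal (norm (?t i \<omega>))) \<partial>M)"
      using f by (intro nn_integral_sum[symmetric]) auto
    also have "\<dots> \<le> (\<integral>\<^sup>+\<omega>. ennreal (norm (u \<omega>)) + ennreal (norm (u \<omega> - (\<Sum>i<n. ?t i \<omega>))) \<partial>M)"
    proof (rule nn_integral_mono_AE)
      show "AE \<omega> in M. (\<Sum>i<n. ennreal (norm (?t i \<omega>)))
          \<le> ennreal (norm (u \<omega>)) + ennreal (norm (u \<omega> - (\<Sum>i<n. ?t i \<omega>)))"
        using norm_sum
      proof eventually_elim
        case (elim \<omega>)
        have "norm (\<Sum>i<n. ?t i \<omega>) \<le> norm (u \<omega>) + norm (u \<omega> - (\<Sum>i<n. ?t i \<omega>))"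
          by (metis norm_minus_commute norm_triangle_sub)
        then show ?case
          using elim by (simp add: sum_ennreal ennreal_plus[symmetric] ennreal_leI del: ennreal_plus)
      qed
    qed
    also have "\<dots> = ennreal (L1_norm M u) + ?e n"
      using r bochner_L1D(3)[OF u] by (subst nn_integral_add) (auto simp: bochner_L1D(4)[OF u])
    finally show ?thesis .
  qed
  \<comment> \<open>The number \<open>m\<close> of terms stays fixed while the error index
    \<open>n\<close> tends to infinity.\<close>
  have bound: "(\<Sum>i<m. term_norm M f y i) \<le> L1_norm M u" for m
  proof -
    have "(\<lambda>n. ennreal (L1_norm M u) + ?e n) \<longlonglongrightarrow> ennreal (L1_norm M u) + 0"
      by (intro tendsto_add tendsto_const e)
    moreover have "\<forall>\<^sub>F n in sequentially.
        ennreal (\<Sum>i<m. term_norm M f y i) \<le> ennreal (L1_norm M u) + ?e n"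
      using eventually_ge_at_top[of m]
    proof eventually_elim
      case (elim n)
      have "(\<Sum>i<m. term_norm M f y i) \<le> (\<Sum>i<n. term_norm M f y i)"
        using elim by (intro sum_mono2) (auto simp: L1_norm_nonneg)
      then show ?case using partial[of n] ennreal_leI order_trans by blast
    qed
    ultimately have "ennreal (\<Sum>i<m. term_norm M f y i) \<le> ennreal (L1_norm M u) + 0"
      by (rule tendsto_lowerbound) simp
    then show ?thesis by (simp add: L1_norm_nonneg)
  qed
  have sm: "summable (term_norm M f y)"
    by (rule summableI_nonneg_bounded[OF _ bound]) (simp add: L1_norm_nonneg)
  have "(\<Sum>i. term_norm M f y i) = L1_norm M u"
    using suminf_le_const[OF sm bound] L1_norm_le_suminf[OF u ts sm] by simp
  then show ?thesis using sm by (simp add: sums_iff)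
qed

section \<open>From norm attainment to countably many lines\<close>

lemma sums_L1_norm_imp_AE_norm_eq:
  assumes u: "bochner_L1 M u" and ts: "tensor_sums M scl f y u"
    and sums: "term_norm M f y sums L1_norm M u"
  shows "AE \<omega> in M. summable (\<lambda>i. norm (tensor scl (f i) (y i) \<omega>)) \<and>
    u \<omega> = (\<Sum>i. tensor scl (f i) (y i) \<omega>) \<and>
    norm (u \<omega>) = (\<Sum>i. norm (tensor scl (f i) (y i) \<omega>))"
proof -
  let ?t = "\<lambda>i. tensor scl (f i) (y i)"
  let ?T = "\<lambda>\<omega>. \<Sum>i. ennreal (norm (?t i \<omega>))"
  have f: "\<And>i. integrable M (f i)" using ts by (simp add: tensor_sums_def)
  have sm: "summable (term_norm M f y)" using sums by (simp add: sums_iff)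
  note AE = tensor_sums_AE[OF u ts sm]
  have le: "AE \<omega> in M. ennreal (norm (u \<omega>)) \<le> ?T \<omega>"
    using AE
  proof eventually_elim
    case (elim \<omega>)
    then show ?case by (auto simp: suminf_ennreal2 intro!: ennreal_leI summable_norm)
  qed
  have T [measurable]: "?T \<in> borel_measurable M"
    using f by (intro borel_measurable_suminf_order) auto
  have nu [measurable]: "(\<lambda>\<omega>. ennreal (norm (u \<omega>))) \<in> borel_measurable M"
    using bochner_L1D(3)[OF u] by measurable
  \<comment> \<open>By attainment \<open>?T\<close> and the norm of \<open>u\<close> have the same
    finite integral. Since \<open>?T\<close> dominates almost everywhere, their difference must
    vanish almost everywhere.\<close>
  have T_eq: "(\<integral>\<^sup>+\<omega>. ?T \<omega> \<partial>M) = ennreal (L1_norm M u)"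
    using sums by (simp add: nn_integral_suminf_norm_tensor[OF f sm] sums_iff)
  have "(\<integral>\<^sup>+\<omega>. ?T \<omega> - ennreal (norm (u \<omega>)) \<partial>M) = ennreal (L1_norm M u) - ennreal (L1_norm M u)"
    by (subst nn_integral_diff[OF T nu _ le]) (simp_all add: T_eq bochner_L1D(4)[OF u])
  then have "(\<integral>\<^sup>+\<omega>. ?T \<omega> - ennreal (norm (u \<omega>)) \<partial>M) = 0" by simp
  then have "AE \<omega> in M. ?T \<omega> - ennreal (norm (u \<omega>)) = 0"
    by (rule nn_integral_0_iff_AE[THEN iffD1, rotated]) (rule borel_measurable_minus_ennreal[OF T nu])
  then show ?thesis
    using AE
  proof eventually_elim
    case (elim \<omega>)
    then have s: "summable (\<lambda>i. norm (?t i \<omega>))" by blast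
    have "ennreal (\<Sum>i. norm (?t i \<omega>)) \<le> ennreal (norm (u \<omega>))"
      using elim(1) by (simp add: suminf_ennreal2[OF _ s] diff_eq_0_iff_ennreal)
    then show ?case
      using elim(2) summable_norm[OF s] by auto
  qed
qed

lemma attains_imp_spans:
  assumes sc: "strictly_convex TYPE('b)" and ex: "\<exists>y::'b. y \<noteq> 0"
    and u: "bochner_L1 M u" and ts: "tensor_sums M scl f y u"
    and sums: "term_norm M f y sums L1_norm M u"
  shows "\<exists>z::nat \<Rightarrow> 'b. range z \<subseteq> sphere 0 1 \<and> {\<omega> \<in> space M. u \<omega> \<notin> (\<Union>n. span {z n})} \<in> null_sets M"
proof -
  note [measurable] = bochner_L1D(2)[OF u]
  obtain e0 :: 'b where "e0 \<noteq> 0" using ex by blast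
  define e where "e = sgn e0"
  have e: "norm e = 1" using \<open>e0 \<noteq> 0\<close> by (simp add: e_def norm_sgn)
  \<comment> \<open>A zero vector \<open>y n\<close> spans no line, so an arbitrary unit vector
    \<open>e\<close> stands in to keep the sequence on the sphere.\<close>
  define z where "z n = (if y n = 0 then e else sgn (y n))" for n
  have z: "range z \<subseteq> sphere 0 1" by (auto simp: z_def e norm_sgn)
  have y_span: "r *\<^sub>R scl c (y n) \<in> span {z n}" if "y n \<noteq> 0" for r c n
  proof -
    have "scl (of_real (norm (y n))) (z n) \<in> span {z n}"
      by (intro span_scale span_base) simp
    also have "scl (of_real (norm (y n))) (z n) = y n"
      using that by (simp add: scale_of_real z_def sgn_div_norm)
    finally have "y n \<in> span {z n}" .
    \<comment> \<open>The real factor is rewritten as a scalar of type \<open>'k\<close>, since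
      \<open>span\<close> is taken over that field.\<close>
    then show ?thesis
      by (subst scale_of_real[symmetric]) (intro span_scale)
  qed
  have AE: "AE \<omega> in M. u \<omega> \<in> (\<Union>n. span {z n})"
    using sums_L1_norm_imp_AE_norm_eq[OF u ts sums]
  proof eventually_elim
    case (elim \<omega>)
    show ?case
    proof (cases "\<exists>j. tensor scl (f j) (y j) \<omega> \<noteq> 0")
      case True
      then obtain j where j: "tensor scl (f j) (y j) \<omega> \<noteq> 0" by blast
      then have "y j \<noteq> 0" by (auto simp: tensor_def)
      let ?z = "\<lambda>i. tensor scl (f i) (y i) \<omega>"
      have "norm (\<Sum>i. ?z i) = (\<Sum>i. norm (?z i))"
        using elim by metis
      then have "\<exists>r. (\<Sum>i. ?z i) = r *\<^sub>R ?z j"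
        by (intro strictly_convex_suminf_eq[OF sc]) (use elim j in blast)+
      then obtain r where "u \<omega> = r *\<^sub>R scl (f j \<omega>) (y j)"
        using elim by (metis tensor_def)
      then show ?thesis
        using y_span[OF \<open>y j \<noteq> 0\<close>, of r "f j \<omega>"] by (metis UNIV_I UN_I)
    next
      case False
      then show ?thesis using elim by (auto simp: span_zero)
    qed
  qed
  have sets: "{\<omega> \<in> space M. \<not> u \<omega> \<in> (\<Union>n. span {z n})} \<in> sets M"
  proof -
    have [measurable]: "(\<Union>n. span {z n}) \<in> sets borel"
      by (intro sets.countable_UN) (auto intro: borel_closed closed_span_singleton)
    show ?thesis by measurable
  qed
  have "{\<omega> \<in> space M. u \<omega> \<notin> (\<Union>n. span {z n})} \<in> null_sets M"
    using iffD1[OF AE_iff_null[OF sets] AE] .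
  then show ?thesis using z by (intro exI[of _ z] conjI)
qed

end

theorem theorem3p2:
  fixes M :: "'a measure"
    and scl :: "'k::{real_normed_field, banach, second_countable_topology} \<Rightarrow> 'b::banach \<Rightarrow> 'b"
    and u :: "'a \<Rightarrow> 'b"
  assumes "banach_space_over scl"
    and "strictly_convex TYPE('b)"
    and "\<exists>y::'b. y \<noteq> 0"
    and "bochner_L1 M u"
  shows "(u \<in> NA_proj M scl \<longleftrightarrow>
           (\<exists>f y. tensor_sums M scl f y u \<and>
              (\<forall>i j. i \<noteq> j \<longrightarrow>
                 {\<omega> \<in> space M. f i \<omega> \<noteq> 0} \<inter> {\<omega> \<in> space M. f j \<omega> \<noteq> 0} \<in> null_sets M))) \<and>
         (u \<in> NA_proj M scl \<longleftrightarrow>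
           (\<exists>y::nat \<Rightarrow> 'b. range y \<subseteq> sphere 0 1 \<and>
              {\<omega> \<in> space M. u \<omega> \<notin> (\<Union>n. module.span scl {y n})} \<in> null_sets M))"
    (is "(?i \<longleftrightarrow> ?ii) \<and> (?i \<longleftrightarrow> ?iii)")
proof -
  interpret banach_space_over scl by fact
  note u = \<open>bochner_L1 M u\<close>
  \<comment> \<open>With the projective norm identified, attainment means that the costs of some
    representation sum to \<open>L1_norm M u\<close>.\<close>
  have i: "?i \<longleftrightarrow> (\<exists>f y. tensor_sums M scl f y u \<and> term_norm M f y sums L1_norm M u)"
    by (simp add: NA_proj_def u projective_norm_eq_L1_norm[OF u])
  \<comment> \<open>The cycle is (i) to (iii) to (ii) to (i); strict convexity enters in this first
    implication.\<close>
  have "?i \<Longrightarrow> ?iii"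
    unfolding i using attains_imp_spans[OF assms(2,3) u] by blast
  moreover have ?ii if ?iii
  proof -
    from that obtain y :: "nat \<Rightarrow> 'b" where y: "range y \<subseteq> sphere 0 1"
      "{\<omega> \<in> space M. u \<omega> \<notin> (\<Union>n. span {y n})} \<in> null_sets M" by blast
    obtain f where "tensor_sums M scl f y u"
      "\<And>i j. i \<noteq> j \<Longrightarrow> {\<omega> \<in> space M. f i \<omega> \<noteq> 0} \<inter> {\<omega> \<in> space M. f j \<omega> \<noteq> 0} = {}"
      using spans_imp_disjoint_tensor_sums[OF u y] by blast
    then show ?thesis by (intro exI[of _ f] exI[of _ y]) simp
  qed
  moreover have "?ii \<Longrightarrow> ?i"
    unfolding i using disjoint_tensor_sums_imp_sums_L1_norm[OF u] by blast
  ultimately show ?thesis by blast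
qed

end
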